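(* Let $k$ be a reproducing kernel on a non-empty set $\mathcal X$ with Hilbert function space $\mathcal H_k$, and let $b\in \mathrm{Mult}(\mathcal H_k\otimes\ell^2,\mathcal H_k)$ with $\|M_b\|\le 1$. Suppose that $\Delta=(I-M_b^*M_b)^{1/2}$ is injective and let $$\mathcal M=\{(bf,f): f\in\mathcal H_k\otimes\ell^2\}\subset \mathcal H_k\oplus\mathcal L_\Delta .$$ Then the map $J:\mathcal M^\perp\to\mathcal H_k(b)$, $J(u,v)=u$, is unitary. Equivalently, for every $f\in\mathcal H_k(b)$ there exists a unique $g\in\mathcal L_\Delta$ such that $(f,g)\in\mathcal M^\perp$, and $$\|f\|_{\mathcal H_k(b)}^2=\|f\|_{\mathcal H_k}^2+\|g\|_{\mathcal L_\Delta}^2 .$$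
   Context: A reproducing kernel on $\mathcal X$ is a positive semi-definite function $k:\mathcal X\times\mathcal X\to\mathbb C$; $\mathcal H_k$ is the Hilbert space of complex-valued functions on $\mathcal X$ with $f(y)=\langle f,k_y\rangle$, $k_y=k(\cdot,y)$. $\mathcal H_k\otimes\ell^2$ is the Hilbert space of functions $f=(f_0,f_1,\dots)^T:\mathcal X\to\ell^2$ with $f_j\in\mathcal H_k$ and $\|f\|^2=\sum_j\|f_j\|_{\mathcal H_k}^2<\infty$. A multiplier $b=(b_0,b_1,\dots)\in\mathrm{Mult}(\mathcal H_k\otimes\ell^2,\mathcal H_k)$ is a row-vector valued function on $\mathcal X$ such that $M_bf:=bf=\sum_j b_jf_j\in\mathcal H_k$ for every $f\in\mathcal H_k\otimes\ell^2$; $M_b$ is the resulting bounded operator. When $\|M_b\|\le1$, $\mathcal H_k(b)$ denotes the Hilbert function space on $\mathcal X$ with reproducing kernel $k^b(x,y)=k(x,y)(1-b(x)b(y)^* )$, where $b(x)b(y)^*=\sum_j b_j(x)\overline{b_j(y)}$. When $\Delta:\mathcal H_k\otimes\ell^2\to\mathcal H_k\otimes\ell^2$ is injective, $\|f\|_\Delta=\|\Delta f\|_{\mathcal H_k\otimes\ell^2}$ is a norm on $\mathcal H_k\otimes\ell^2$, and $\mathcal L_\Delta$ is the Hilbert space completion of $\mathcal H_k\otimes\ell^2$ in this norm; $\mathcal H_k\otimes\ell^2$ is regarded as a dense subspace of $\mathcal L_\Delta$. $\mathcal M$ is a closed subspace of the orthogonal direct sum $\mathcal H_k\oplus\mathcal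 L_\Delta$ and $\mathcal M^\perp$ is its orthogonal complement there. *)

theory Defs
  imports "HOL-Analysis.Analysis" "HOL-Library.Function_Algebras"
begin

section \<open>Complex inner product spaces on a carrier\<close>

text \<open>
  The spaces of interest depend on a kernel, so they are carriers inside an ambient complex vector
  space type. Inner products are linear in the first argument; their values are constrained on the
  carrier only.
\<close>

locale cinner_space = vector_space scale
  for scale :: "complex \<Rightarrow> 'a::ab_group_add \<Rightarrow> 'a" +
  fixes H :: "'a set" and ip :: "'a \<Rightarrow> 'a \<Rightarrow> complex"
  assumes carrier_subspace: "subspace H"
    and ip_add_left: "\<lbrakk>f \<in> H; g \<in> H; h \<in> H\<rbrakk> \<Longrightarrow> ip (f + g) h = ip f h + ip g h"
    and ip_scale_left: "\<lbrakk>f \<in> H; g \<in> H\<rbrakk> \<Longrightarrow> ip (scale c f) g = c * ip f g"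
    and ip_commute: "\<lbrakk>f \<in> H; g \<in> H\<rbrakk> \<Longrightarrow> ip g f = cnj (ip f g)"
    and ip_nonneg: "f \<in> H \<Longrightarrow> ip f f \<in> \<real>\<^sub>\<ge>\<^sub>0"
    and ip_definite: "\<lbrakk>f \<in> H; ip f f = 0\<rbrakk> \<Longrightarrow> f = 0"

definition ip_norm :: "('a \<Rightarrow> 'a \<Rightarrow> complex) \<Rightarrow> 'a \<Rightarrow> real" where
  "ip_norm ip f = sqrt (Re (ip f f))"

locale chilbert_space = cinner_space +
  assumes complete:
    "\<lbrakk>\<And>n. s n \<in> H;
      \<And>e. e > 0 \<Longrightarrow> \<exists>N. \<forall>m\<ge>N. \<forall>n\<ge>N. ip_norm ip (s m - s n) < e\<rbrakk>
     \<Longrightarrow> \<exists>l\<in>H. (\<lambda>n. ip_norm ip (s n - l)) \<longlonglongrightarrow> 0"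

definition clinear_on ::
  "(complex \<Rightarrow> 'a::ab_group_add \<Rightarrow> 'a) \<Rightarrow> (complex \<Rightarrow> 'b::ab_group_add \<Rightarrow> 'b)
    \<Rightarrow> 'a set \<Rightarrow> ('a \<Rightarrow> 'b) \<Rightarrow> bool" where
  "clinear_on s1 s2 H T \<longleftrightarrow>
     (\<forall>f\<in>H. \<forall>g\<in>H. T (f + g) = T f + T g) \<and> (\<forall>c. \<forall>f\<in>H. T (s1 c f) = s2 c (T f))"

definition opnorm_le ::
  "'a set \<Rightarrow> ('a \<Rightarrow> 'a \<Rightarrow> complex) \<Rightarrow> ('b \<Rightarrow> 'b \<Rightarrow> complex) \<Rightarrow> ('a \<Rightarrow> 'b) \<Rightarrow> real \<Rightarrow> bool" where
  "opnorm_le H ip1 ip2 T C \<longleftrightarrow> (\<forall>f\<in>H. ip_norm ip2 (T f) \<le> C * ip_norm ip1 f)"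

definition is_adjoint ::
  "'a set \<Rightarrow> ('a \<Rightarrow> 'a \<Rightarrow> complex) \<Rightarrow> 'b set \<Rightarrow> ('b \<Rightarrow> 'b \<Rightarrow> complex)
    \<Rightarrow> ('a \<Rightarrow> 'b) \<Rightarrow> ('b \<Rightarrow> 'a) \<Rightarrow> bool" where
  "is_adjoint H1 ip1 H2 ip2 T S \<longleftrightarrow>
     S \<in> H2 \<rightarrow> H1 \<and> (\<forall>f\<in>H1. \<forall>g\<in>H2. ip2 (T f) g = ip1 f (S g))"

text \<open>\<open>D\<close> is the positive square root of \<open>A\<close>: a positive bounded operator with square \<open>A\<close>.\<close>

definition is_pos_sqrt ::
  "(complex \<Rightarrow> 'a::ab_group_add \<Rightarrow> 'a) \<Rightarrow> 'a set \<Rightarrow> ('a \<Rightarrow> 'a \<Rightarrow> complex)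
    \<Rightarrow> ('a \<Rightarrow> 'a) \<Rightarrow> ('a \<Rightarrow> 'a) \<Rightarrow> bool" where
  "is_pos_sqrt s H ip A D \<longleftrightarrow>
     D \<in> H \<rightarrow> H \<and> clinear_on s s H D \<and> (\<exists>C. opnorm_le H ip ip D C) \<and>
     (\<forall>f\<in>H. ip (D f) f \<in> \<real>\<^sub>\<ge>\<^sub>0) \<and> (\<forall>f\<in>H. D (D f) = A f)"

text \<open>
  The Hilbert space \<open>(L, ipL)\<close> is a completion of the carrier \<open>V\<close> with respect to the norm \<open>N\<close>;
  the map \<open>\<iota>\<close> is the isometric inclusion of \<open>V\<close> as a dense subspace.
\<close>

definition is_hilbert_completion ::
  "(complex \<Rightarrow> 'a::ab_group_add \<Rightarrow> 'a) \<Rightarrow> 'a set \<Rightarrow> ('a \<Rightarrow> real)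
    \<Rightarrow> (complex \<Rightarrow> 'l::ab_group_add \<Rightarrow> 'l) \<Rightarrow> 'l set \<Rightarrow> ('l \<Rightarrow> 'l \<Rightarrow> complex)
    \<Rightarrow> ('a \<Rightarrow> 'l) \<Rightarrow> bool" where
  "is_hilbert_completion sV V N sL L ipL \<iota> \<longleftrightarrow>
     chilbert_space sL L ipL \<and> \<iota> \<in> V \<rightarrow> L \<and> clinear_on sV sL V \<iota> \<and>
     (\<forall>f\<in>V. ip_norm ipL (\<iota> f) = N f) \<and>
     (\<forall>g\<in>L. \<forall>e>0. \<exists>f\<in>V. ip_norm ipL (g - \<iota> f) < e)"

definition unitary_between ::
  "(complex \<Rightarrow> 'a::ab_group_add \<Rightarrow> 'a) \<Rightarrow> 'a set \<Rightarrow> ('a \<Rightarrow> 'a \<Rightarrow> complex)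
    \<Rightarrow> (complex \<Rightarrow> 'b::ab_group_add \<Rightarrow> 'b) \<Rightarrow> 'b set \<Rightarrow> ('b \<Rightarrow> 'b \<Rightarrow> complex)
    \<Rightarrow> ('a \<Rightarrow> 'b) \<Rightarrow> bool" where
  "unitary_between s1 H1 ip1 s2 H2 ip2 U \<longleftrightarrow>
     clinear_on s1 s2 H1 U \<and> bij_betw U H1 H2 \<and>
     (\<forall>f\<in>H1. \<forall>g\<in>H1. ip2 (U f) (U g) = ip1 f g)"

text \<open>The carrier of the orthogonal direct sum is \<open>H1 \<times> H2\<close>.\<close>

definition dsum_scale ::
  "(complex \<Rightarrow> 'a \<Rightarrow> 'a) \<Rightarrow> (complex \<Rightarrow> 'b \<Rightarrow> 'b) \<Rightarrow> complex \<Rightarrow> 'a \<times> 'b \<Rightarrow> 'a \<times> 'b" where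
  "dsum_scale s1 s2 c p = (s1 c (fst p), s2 c (snd p))"

definition dsum_ip ::
  "('a \<Rightarrow> 'a \<Rightarrow> complex) \<Rightarrow> ('b \<Rightarrow> 'b \<Rightarrow> complex) \<Rightarrow> 'a \<times> 'b \<Rightarrow> 'a \<times> 'b \<Rightarrow> complex" where
  "dsum_ip ip1 ip2 p q = ip1 (fst p) (fst q) + ip2 (snd p) (snd q)"

definition ortho_compl :: "'a set \<Rightarrow> ('a \<Rightarrow> 'a \<Rightarrow> complex) \<Rightarrow> 'a set \<Rightarrow> 'a set" where
  "ortho_compl H ip M = {p \<in> H. \<forall>m\<in>M. ip p m = 0}"


section \<open>Hilbert function spaces and multipliers\<close>

text \<open>The non-empty set on which the functions live is the type \<open>'x\<close>.\<close>

definition fun_scale :: "complex \<Rightarrow> ('x \<Rightarrow> complex) \<Rightarrow> 'x \<Rightarrow> complex" where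
  "fun_scale c f = (\<lambda>x. c * f x)"

definition reproducing_kernel :: "('x \<Rightarrow> 'x \<Rightarrow> complex) \<Rightarrow> bool" where
  "reproducing_kernel k \<longleftrightarrow>
     (\<forall>S c. finite S \<longrightarrow> (\<Sum>x\<in>S. \<Sum>y\<in>S. c x * cnj (c y) * k x y) \<in> \<real>\<^sub>\<ge>\<^sub>0)"

definition is_hilbert_function_space ::
  "('x \<Rightarrow> 'x \<Rightarrow> complex) \<Rightarrow> ('x \<Rightarrow> complex) set
    \<Rightarrow> (('x \<Rightarrow> complex) \<Rightarrow> ('x \<Rightarrow> complex) \<Rightarrow> complex) \<Rightarrow> bool" where
  "is_hilbert_function_space k H ip \<longleftrightarrow>
     chilbert_space fun_scale H ip \<and>
     (\<forall>y. (\<lambda>x. k x y) \<in> H) \<and> (\<forall>f\<in>H. \<forall>y. f y = ip f (\<lambda>x. k x y))"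

text \<open>\<open>H \<otimes> \<ell>\<^sup>2\<close>, whose elements are functions \<open>f\<close> on \<open>'x\<close> with components \<open>f\<^sub>j = (\<lambda>x. f x j)\<close>.\<close>

definition tensor_l2 ::
  "('x \<Rightarrow> complex) set \<Rightarrow> (('x \<Rightarrow> complex) \<Rightarrow> ('x \<Rightarrow> complex) \<Rightarrow> complex)
    \<Rightarrow> ('x \<Rightarrow> nat \<Rightarrow> complex) set" where
  "tensor_l2 H ip = {f. (\<forall>j. (\<lambda>x. f x j) \<in> H) \<and> summable (\<lambda>j. (ip_norm ip (\<lambda>x. f x j))\<^sup>2)}"

definition tensor_l2_ip ::
  "(('x \<Rightarrow> complex) \<Rightarrow> ('x \<Rightarrow> complex) \<Rightarrow> complex)
    \<Rightarrow> ('x \<Rightarrow> nat \<Rightarrow> complex) \<Rightarrow> ('x \<Rightarrow> nat \<Rightarrow> complex) \<Rightarrow> complex" where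
  "tensor_l2_ip ip f g = (\<Sum>j. ip (\<lambda>x. f x j) (\<lambda>x. g x j))"

definition tensor_l2_scale ::
  "complex \<Rightarrow> ('x \<Rightarrow> nat \<Rightarrow> complex) \<Rightarrow> 'x \<Rightarrow> nat \<Rightarrow> complex" where
  "tensor_l2_scale c f = (\<lambda>x j. c * f x j)"

definition mult_op ::
  "('x \<Rightarrow> nat \<Rightarrow> complex) \<Rightarrow> ('x \<Rightarrow> nat \<Rightarrow> complex) \<Rightarrow> 'x \<Rightarrow> complex" where
  "mult_op b f = (\<lambda>x. \<Sum>j. b x j * f x j)"

text \<open>
  Since \<open>suminf\<close> is total, pointwise convergence of the series is required separately.
\<close>

definition row_multiplier ::
  "('x \<Rightarrow> complex) set \<Rightarrow> (('x \<Rightarrow> complex) \<Rightarrow> ('x \<Rightarrow> complex) \<Rightarrow> complex)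
    \<Rightarrow> ('x \<Rightarrow> nat \<Rightarrow> complex) \<Rightarrow> bool" where
  "row_multiplier H ip b \<longleftrightarrow>
     (\<forall>f\<in>tensor_l2 H ip. (\<forall>x. summable (\<lambda>j. b x j * f x j)) \<and> mult_op b f \<in> H)"

text \<open>
  For a row multiplier \<open>b\<close> the series below converges whenever \<open>k x x\<close> and \<open>k y y\<close> are nonzero;
  otherwise \<open>k x y = 0\<close>, so the value of the second factor is irrelevant.
\<close>

definition mult_kernel ::
  "('x \<Rightarrow> 'x \<Rightarrow> complex) \<Rightarrow> ('x \<Rightarrow> nat \<Rightarrow> complex) \<Rightarrow> 'x \<Rightarrow> 'x \<Rightarrow> complex" where
  "mult_kernel k b = (\<lambda>x y. k x y * (1 - (\<Sum>j. b x j * cnj (b y j))))"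

definition graph_space ::
  "('x \<Rightarrow> nat \<Rightarrow> complex) \<Rightarrow> ('x \<Rightarrow> nat \<Rightarrow> complex) set \<Rightarrow> (('x \<Rightarrow> nat \<Rightarrow> complex) \<Rightarrow> 'l)
    \<Rightarrow> (('x \<Rightarrow> complex) \<times> 'l) set" where
  "graph_space b T \<iota> = (\<lambda>f. (mult_op b f, \<iota> f)) ` T"

end

theory Submission
  imports Defs
begin

text \<open>
  Since \<open>\<Delta>\<^sup>2 = I - M\<^sub>b\<^sup>* M\<^sub>b\<close>, the graph map \<open>V f = (b f, f)\<close> is an isometry into the direct sum, so that
  \<open>I - V V\<^sup>*\<close> is the projection onto \<open>\<M>\<^sup>\<bottom>\<close>. It sends \<open>(k\<^sub>y, 0)\<close> to an element \<open>p\<^sub>y\<close> that represents the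
  evaluation \<open>(u, v) \<mapsto> u y\<close> on \<open>\<M>\<^sup>\<bottom>\<close> and whose first component is \<open>k\<^sub>y - M\<^sub>b M\<^sub>b\<^sup>* k\<^sub>y = k\<^sup>b\<^sub>y\<close>. As \<open>J\<close> is
  injective by density of the range of \<open>\<iota>\<close>, the families \<open>p\<^sub>y\<close> and \<open>k\<^sup>b\<^sub>y\<close> are total with the same Gram
  matrix, and \<open>J\<close> is the unitary that matches them.
\<close>

section \<open>Geometry of complex inner product spaces\<close>

context cinner_space
begin

lemma zero_mem: "0 \<in> H"
  and add_mem: "f \<in> H \<Longrightarrow> g \<in> H \<Longrightarrow> f + g \<in> H"
  and scale_mem: "f \<in> H \<Longrightarrow> scale c f \<in> H"
  and diff_mem: "f \<in> H \<Longrightarrow> g \<in> H \<Longrightarrow> f - g \<in> H"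
  and minus_mem: "f \<in> H \<Longrightarrow> - f \<in> H"
  using carrier_subspace
  by (auto intro: subspace_0 subspace_add subspace_scale subspace_diff subspace_neg)

lemma ip_add_right:
  assumes "f \<in> H" "g \<in> H" "h \<in> H"
  shows "ip h (f + g) = ip h f + ip h g"
  using assms by (metis add_mem complex_cnj_add ip_add_left ip_commute)

lemma ip_scale_right:
  assumes "f \<in> H" "g \<in> H"
  shows "ip f (scale c g) = cnj c * ip f g"
  using assms by (metis scale_mem complex_cnj_mult ip_scale_left ip_commute)

lemma ip_minus_left: "f \<in> H \<Longrightarrow> g \<in> H \<Longrightarrow> ip (- f) g = - ip f g"
  using ip_scale_left[of f g "-1"] by simp

lemma ip_minus_right: "f \<in> H \<Longrightarrow> g \<in> H \<Longrightarrow> ip f (- g) = - ip f g"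
  using ip_scale_right[of f g "-1"] by simp

lemma ip_diff_left:
  assumes "f \<in> H" "g \<in> H" "h \<in> H"
  shows "ip (f - g) h = ip f h - ip g h"
  using ip_add_left[of f "- g" h] assms by (simp add: minus_mem ip_minus_left)

lemma ip_diff_right:
  assumes "f \<in> H" "g \<in> H" "h \<in> H"
  shows "ip h (f - g) = ip h f - ip h g"
  using ip_add_right[of f "- g" h] assms by (simp add: minus_mem ip_minus_right)

lemma ip_zero_left: "f \<in> H \<Longrightarrow> ip 0 f = 0"
  using ip_diff_left[of f f f] by simp

lemma ip_zero_right: "f \<in> H \<Longrightarrow> ip f 0 = 0"
  using ip_diff_right[of f f f] by simp

lemmas mem = zero_mem add_mem scale_mem diff_mem minus_mem

lemmas ip_bilinear = ip_add_left ip_add_right ip_scale_left ip_scale_right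
  ip_diff_left ip_diff_right ip_minus_left ip_minus_right

section \<open>The norm of an inner product and the Cauchy-Schwarz inequality\<close>

lemma ip_norm_nonneg: "f \<in> H \<Longrightarrow> 0 \<le> ip_norm ip f"
  using ip_nonneg[of f] by (simp add: ip_norm_def complex_nonneg_Reals_iff)

lemma ip_norm_sq: "f \<in> H \<Longrightarrow> (ip_norm ip f)\<^sup>2 = Re (ip f f)"
  using ip_nonneg[of f] by (simp add: ip_norm_def complex_nonneg_Reals_iff)

lemma ip_self: "f \<in> H \<Longrightarrow> ip f f = complex_of_real ((ip_norm ip f)\<^sup>2)"
  using ip_nonneg[of f] by (simp add: ip_norm_sq complex_nonneg_Reals_iff complex_eq_iff)

lemma ip_norm_eq_0: "f \<in> H \<Longrightarrow> ip_norm ip f = 0 \<longleftrightarrow> f = 0"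
  using ip_self[of f] ip_definite[of f] by (auto simp: ip_norm_def ip_zero_left)

lemma ip_norm_minus: "f \<in> H \<Longrightarrow> ip_norm ip (- f) = ip_norm ip f"
  by (simp add: ip_norm_def ip_minus_left ip_minus_right minus_mem)

lemma ip_norm_diff_commute:
  assumes "f \<in> H" "g \<in> H"
  shows "ip_norm ip (f - g) = ip_norm ip (g - f)"
  using ip_norm_minus[OF diff_mem[OF assms]] by simp

lemma ip_norm_scale: "f \<in> H \<Longrightarrow> ip_norm ip (scale c f) = cmod c * ip_norm ip f"
proof -
  assume f: "f \<in> H"
  have "ip (scale c f) (scale c f) = complex_of_real ((cmod c * ip_norm ip f)\<^sup>2)"
    using f by (simp add: ip_scale_left ip_scale_right scale_mem ip_self[OF f]
        power_mult_distrib complex_norm_square[of c, simplified of_real_power])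
  then show ?thesis
    using ip_norm_nonneg[OF f] by (simp add: ip_norm_def abs_mult)
qed

lemma Cauchy_Schwarz:
  assumes f: "f \<in> H" and g: "g \<in> H"
  shows "cmod (ip f g) \<le> ip_norm ip f * ip_norm ip g"
proof (cases "g = 0")
  case True
  then show ?thesis using f ip_norm_eq_0[OF zero_mem] by (simp add: ip_zero_right)
next
  case False
  define N where "N = (ip_norm ip g)\<^sup>2"
  have N: "N > 0" using False ip_norm_eq_0[OF g] by (simp add: N_def)
  \<comment> \<open>\<open>h\<close> is \<open>N\<close> times the residual of \<open>f\<close>
    after projection onto the line through \<open>g\<close>. Scaling by \<open>N\<close> avoids
    division, and nonnegativity of \<open>ip h h\<close> is the inequality.\<close>
  define h where "h = scale (of_real N) f - scale (ip f g) g"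
  have h: "h \<in> H" by (simp add: h_def f g mem)
  have gf: "ip g f = cnj (ip f g)" using f g by (rule ip_commute)
  have gg: "ip g g = of_real N" using ip_self[OF g] by (simp add: N_def)
  have "ip h h = of_real N * (of_real N * ip f f - ip f g * cnj (ip f g))"
    by (simp add: h_def f g mem ip_bilinear gf gg algebra_simps)
  also have "\<dots> = of_real (N * (N * (ip_norm ip f)\<^sup>2 - (cmod (ip f g))\<^sup>2))"
    using complex_norm_square[of "ip f g"] by (simp add: ip_self[OF f])
  finally have "Re (ip h h) = N * (N * (ip_norm ip f)\<^sup>2 - (cmod (ip f g))\<^sup>2)" by simp
  then have "0 \<le> N * (N * (ip_norm ip f)\<^sup>2 - (cmod (ip f g))\<^sup>2)"
    using ip_norm_sq[OF h] by (metis zero_le_power2)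
  then have "(cmod (ip f g))\<^sup>2 \<le> (ip_norm ip f * ip_norm ip g)\<^sup>2"
    using N by (simp add: zero_le_mult_iff N_def power_mult_distrib mult.commute)
  then show ?thesis
    by (rule power2_le_imp_le) (simp add: f g ip_norm_nonneg)
qed

lemma ip_norm_add_sq:
  assumes f: "f \<in> H" and g: "g \<in> H"
  shows "(ip_norm ip (f + g))\<^sup>2 = (ip_norm ip f)\<^sup>2 + 2 * Re (ip f g) + (ip_norm ip g)\<^sup>2"
  using f g by (simp add: ip_norm_sq mem ip_bilinear ip_commute[OF f g])

lemma ip_norm_diff_sq:
  assumes f: "f \<in> H" and g: "g \<in> H"
  shows "(ip_norm ip (f - g))\<^sup>2 = (ip_norm ip f)\<^sup>2 - 2 * Re (ip f g) + (ip_norm ip g)\<^sup>2"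
  using f g by (simp add: ip_norm_sq mem ip_bilinear ip_commute[OF f g])

lemma triangle:
  assumes f: "f \<in> H" and g: "g \<in> H"
  shows "ip_norm ip (f + g) \<le> ip_norm ip f + ip_norm ip g"
proof (rule power2_le_imp_le)
  have "Re (ip f g) \<le> ip_norm ip f * ip_norm ip g"
    using Cauchy_Schwarz[OF f g] complex_Re_le_cmod order_trans by blast
  then show "(ip_norm ip (f + g))\<^sup>2 \<le> (ip_norm ip f + ip_norm ip g)\<^sup>2"
    by (simp add: ip_norm_add_sq[OF f g] power2_sum)
qed (simp add: f g ip_norm_nonneg)

lemma triangle_diff:
  assumes "f \<in> H" "g \<in> H"
  shows "\<bar>ip_norm ip f - ip_norm ip g\<bar> \<le> ip_norm ip (f - g)"
  using triangle[of "f - g" g] triangle[of "g - f" f] assms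
  by (simp add: mem ip_norm_diff_commute[of g f])

section \<open>Continuity of the inner product and of the norm\<close>

lemma tendsto_ip_left:
  assumes s: "\<And>n. s n \<in> H" and l: "l \<in> H" and g: "g \<in> H"
    and lim: "(\<lambda>n. ip_norm ip (s n - l)) \<longlonglongrightarrow> 0"
  shows "(\<lambda>n. ip (s n) g) \<longlonglongrightarrow> ip l g"
proof (rule LIM_zero_cancel, rule Lim_null_comparison)
  show "\<forall>\<^sub>F n in sequentially. norm (ip (s n) g - ip l g) \<le> ip_norm ip (s n - l) * ip_norm ip g"
    using Cauchy_Schwarz[OF diff_mem[OF s l] g] by (simp add: ip_diff_left s l g)
  show "(\<lambda>n. ip_norm ip (s n - l) * ip_norm ip g) \<longlonglongrightarrow> 0"
    using tendsto_mult_left_zero[OF lim] .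
qed

lemma tendsto_ip_norm:
  assumes s: "\<And>n. s n \<in> H" and l: "l \<in> H"
    and lim: "(\<lambda>n. ip_norm ip (s n - l)) \<longlonglongrightarrow> 0"
  shows "(\<lambda>n. ip_norm ip (s n)) \<longlonglongrightarrow> ip_norm ip l"
proof (rule LIM_zero_cancel, rule Lim_null_comparison)
  show "\<forall>\<^sub>F n in sequentially. norm (ip_norm ip (s n) - ip_norm ip l) \<le> ip_norm ip (s n - l)"
    using triangle_diff[OF s l] by simp
qed (rule lim)

lemma convergent_imp_Cauchy:
  assumes s: "\<And>n. s n \<in> H" and l: "l \<in> H"
    and lim: "(\<lambda>n. ip_norm ip (s n - l)) \<longlonglongrightarrow> 0" and "e > 0"
  shows "\<exists>N. \<forall>m\<ge>N. \<forall>n\<ge>N. ip_norm ip (s m - s n) < e"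
proof -
  obtain N where N: "\<And>n. n \<ge> N \<Longrightarrow> ip_norm ip (s n - l) < e / 2"
    using LIMSEQ_D[OF lim, of "e / 2"] \<open>e > 0\<close> by fastforce
  have "ip_norm ip (s m - s n) < e" if "m \<ge> N" "n \<ge> N" for m n
    using triangle[of "s m - l" "l - s n"] N[OF that(1)] N[OF that(2)] s l
    by (simp add: mem ip_norm_diff_commute[of l])
  then show ?thesis by blast
qed

text \<open>Polarization in the form used below. The diagonal at \<open>f + h\<close> shows that
  \<open>B f h\<close> and \<open>B h f\<close> cancel; for \<open>h = scale \<i> g\<close> the two
  slots pull out opposite factors, so \<open>B f g = B g f\<close> as well, and both vanish.\<close>

lemma sesquilinear_zero:
  assumes "\<And>f g h. f \<in> H \<Longrightarrow> g \<in> H \<Longrightarrow> h \<in> H \<Longrightarrow> B (f + g) h = B f h + B g h"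
    and "\<And>f g h. f \<in> H \<Longrightarrow> g \<in> H \<Longrightarrow> h \<in> H \<Longrightarrow> B h (f + g) = B h f + B h g"
    and "\<And>c f g. f \<in> H \<Longrightarrow> g \<in> H \<Longrightarrow> B (scale c f) g = c * B f g"
    and "\<And>c f g. f \<in> H \<Longrightarrow> g \<in> H \<Longrightarrow> B f (scale c g) = cnj c * B f g"
    and diag: "\<And>f. f \<in> H \<Longrightarrow> B f f = (0::complex)"
    and f: "f \<in> H" and g: "g \<in> H"
  shows "B f g = 0"
proof -
  have sym: "B f h + B h f = 0" if h: "h \<in> H" for h
    using diag[of "f + h"] assms(1-2) diag[OF f] diag[OF h] f h by (simp add: mem add.commute)
  have "\<i> * (B g f - B f g) = 0"
    using sym[of "scale \<i> g"] assms(3,4) f g by (simp add: mem algebra_simps)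
  with sym[OF g] show ?thesis by simp
qed

text \<open>The definition of a positive square root demands positivity but not self-adjointness.
  Over the complex numbers the latter follows: \<open>ip (D f) f\<close> is real, so the
  sesquilinear form measuring the failure of symmetry vanishes on the diagonal.\<close>

lemma positive_imp_symmetric:
  assumes D: "D \<in> H \<rightarrow> H" and lin: "clinear_on scale scale H D"
    and pos: "\<And>f. f \<in> H \<Longrightarrow> ip (D f) f \<in> \<real>\<^sub>\<ge>\<^sub>0"
    and "f \<in> H" "g \<in> H"
  shows "ip (D f) g = ip f (D g)"
proof -
  have DH: "D f \<in> H" if "f \<in> H" for f using D that by blast
  have "ip (D f) g - ip f (D g) = 0"
  proof (rule sesquilinear_zero[where B = "\<lambda>f g. ip (D f) g - ip f (D g)"])
    show "ip (D f) f - ip f (D f) = 0" if f: "f \<in> H" for f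
      using ip_commute[OF DH[OF f] f] pos[OF f] by (simp add: complex_nonneg_Reals_iff complex_eq_iff)
  qed (use lin assms(4,5) in \<open>simp_all add: clinear_on_def DH mem ip_bilinear algebra_simps\<close>)
  then show ?thesis by simp
qed

end

text \<open>The difference of the two inner products is sesquilinear and zero on the diagonal, so
  polarization applies.\<close>

lemma isometry_preserves_ip:
  assumes H1: "cinner_space s1 H1 ip1" and H2: "cinner_space s2 H2 ip2"
    and lin: "clinear_on s1 s2 H1 U" and U: "U \<in> H1 \<rightarrow> H2"
    and iso: "\<And>f. f \<in> H1 \<Longrightarrow> ip2 (U f) (U f) = ip1 f f"
    and f: "f \<in> H1" and g: "g \<in> H1"
  shows "ip2 (U f) (U g) = ip1 f g"
proof -
  interpret A: cinner_space s1 H1 ip1 by fact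
  interpret B: cinner_space s2 H2 ip2 by fact
  have UH: "U f \<in> H2" if "f \<in> H1" for f using U that by blast
  have "ip2 (U f) (U g) - ip1 f g = 0"
    by (rule A.sesquilinear_zero[where B = "\<lambda>f g. ip2 (U f) (U g) - ip1 f g"])
      (use lin iso f g in \<open>simp_all add: clinear_on_def UH A.mem B.mem A.ip_bilinear B.ip_bilinear algebra_simps\<close>)
  then show ?thesis by simp
qed

context chilbert_space
begin

text \<open>The subspace \<open>S\<close> need not be closed, so a minimizing sequence for the
  distance from \<open>w\<close> to \<open>S\<close> is used. It is Cauchy by the parallelogram law,
  its limit \<open>l\<close> leaves a defect \<open>w - l\<close> orthogonal to \<open>S\<close>,
  and totality forces \<open>l = w\<close>.\<close>

lemma total_subspace_dense:
  assumes S: "subspace S" "S \<subseteq> H"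
    and total: "\<And>w. w \<in> H \<Longrightarrow> (\<And>s. s \<in> S \<Longrightarrow> ip w s = 0) \<Longrightarrow> w = 0"
    and w: "w \<in> H"
  shows "\<exists>s. (\<forall>n::nat. s n \<in> S) \<and> (\<lambda>n. ip_norm ip (s n - w)) \<longlonglongrightarrow> 0"
proof -
  define D where "D = (INF s\<in>S. (ip_norm ip (w - s))\<^sup>2)"
  have D_le: "D \<le> (ip_norm ip (w - s))\<^sup>2" if "s \<in> S" for s
    unfolding D_def by (rule cINF_lower[OF bdd_belowI2[of _ 0]]) (use that in auto)
  have "\<exists>s\<in>S. (ip_norm ip (w - s))\<^sup>2 < D + inverse (real (Suc n))" for n
  proof -
    have "S \<noteq> {}" using subspace_0[OF S(1)] by blast
    moreover have "bdd_below ((\<lambda>s. (ip_norm ip (w - s))\<^sup>2) ` S)" by (rule bdd_belowI2[of _ 0]) auto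
    ultimately show ?thesis
      using cINF_less_iff[of S "\<lambda>s. (ip_norm ip (w - s))\<^sup>2" "D + inverse (real (Suc n))"]
      by (simp add: D_def)
  qed
  then obtain s where sS: "\<And>n. s n \<in> S"
    and s_lt: "\<And>n. (ip_norm ip (w - s n))\<^sup>2 < D + inverse (real (Suc n))"
    by metis
  have sH: "s n \<in> H" for n using sS S(2) by blast
  have close: "(ip_norm ip (s m - s n))\<^sup>2 \<le> 2 * inverse (real (Suc m)) + 2 * inverse (real (Suc n))"
    for m n
  proof -
    \<comment> \<open>The midpoint lies in \<open>S\<close>, so its distance to \<open>w\<close> is
      at least the infimum. The parallelogram law for \<open>w - s m\<close> and
      \<open>w - s n\<close> then leaves little room for their difference.\<close>
    let ?mid = "scale (1/2) (s m + s n)"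
    have mid: "?mid \<in> S" using S(1) sS by (simp add: subspace_add subspace_scale)
    have sum: "(w - s m) + (w - s n) = scale 2 (w - ?mid)"
      by (simp add: scale_right_diff_distrib scale_left_distrib[of 1 1 w, simplified])
    have "(ip_norm ip ((w - s m) + (w - s n)))\<^sup>2 = 4 * (ip_norm ip (w - ?mid))\<^sup>2"
      unfolding sum by (simp add: ip_norm_scale mem w sH power_mult_distrib)
    moreover have "(w - s n) - (w - s m) = s m - s n" by simp
    ultimately have "(ip_norm ip (s m - s n))\<^sup>2 + 4 * (ip_norm ip (w - ?mid))\<^sup>2
        = 2 * (ip_norm ip (w - s m))\<^sup>2 + 2 * (ip_norm ip (w - s n))\<^sup>2"
      using ip_norm_add_sq[of "w - s m" "w - s n"] ip_norm_diff_sq[of "w - s n" "w - s m"]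
        ip_commute[of "w - s m" "w - s n"] by (simp add: w sH mem)
    then show ?thesis using D_le[OF mid] s_lt[of m] s_lt[of n] by linarith
  qed
  have "\<exists>N. \<forall>m\<ge>N. \<forall>n\<ge>N. ip_norm ip (s m - s n) < e" if "e > 0" for e
  proof -
    obtain N where N: "inverse (real (Suc N)) < e\<^sup>2 / 4"
      using reals_Archimedean[of "e\<^sup>2 / 4"] \<open>e > 0\<close> by auto
    have "ip_norm ip (s m - s n) < e" if "m \<ge> N" "n \<ge> N" for m n
    proof (rule power2_less_imp_less)
      have "inverse (real (Suc m)) \<le> inverse (real (Suc N))" "inverse (real (Suc n)) \<le> inverse (real (Suc N))"
        using that by simp_all
      then show "(ip_norm ip (s m - s n))\<^sup>2 < e\<^sup>2"
        using close[of m n] N by linarith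
    qed (use \<open>e > 0\<close> in simp)
    then show ?thesis by blast
  qed
  then obtain l where l: "l \<in> H" and lim: "(\<lambda>n. ip_norm ip (s n - l)) \<longlonglongrightarrow> 0"
    using complete[of s] sH by blast
  \<comment> \<open>Orthogonality of the defect: moving from \<open>s n\<close> inside
    \<open>S\<close> cannot bring the squared distance below \<open>D\<close>, while
    \<open>s n\<close> is already within \<open>1 / (n + 1)\<close> of it. Hence the inner products
    of \<open>w - s n\<close> with a fixed \<open>t\<close> tend to zero.\<close>
  have "w - l = 0"
  proof (rule total)
    fix t assume t: "t \<in> S"
    then have tH: "t \<in> H" using S(2) by blast
    define N where "N = (ip_norm ip t)\<^sup>2"
    have N0: "N \<ge> 0" by (simp add: N_def)
    \<comment> \<open>The step length \<open>1 / (N + 1)\<close> makes the quadratic \<open>2 r - r\<^sup>2 N\<close> at least \<open>r\<close>, also when \<open>N = 0\<close>.\<close>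
    have bound: "(cmod (ip (w - s n) t))\<^sup>2 \<le> (N + 1) * inverse (real (Suc n))" for n
    proof -
      define a where "a = ip (w - s n) t"
      define r where "r = 1 / (N + 1)"
      have rN: "r * (N + 1) = 1" "r > 0" using N0 by (auto simp: r_def)
      \<comment> \<open>The coefficient carries the phase of \<open>a\<close>, which makes the cross
        term real and equal to \<open>r\<close> times the square of \<open>cmod a\<close>.\<close>
      let ?v = "scale (of_real r * a) t"
      have v: "?v \<in> S" "?v \<in> H" using t tH S(1) by (auto simp: subspace_scale mem)
      have "D \<le> (ip_norm ip (w - (s n + ?v)))\<^sup>2"
        by (rule D_le) (use S(1) sS v in \<open>simp add: subspace_add\<close>)
      also have "w - (s n + ?v) = (w - s n) - ?v" by simp
      also have "(ip_norm ip \<dots>)\<^sup>2 = (ip_norm ip (w - s n))\<^sup>2 - 2 * Re (ip (w - s n) ?v) + (ip_norm ip ?v)\<^sup>2"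
        by (rule ip_norm_diff_sq) (simp_all add: w sH v mem)
      also have "ip (w - s n) ?v = of_real (r * (cmod a)\<^sup>2)"
        using complex_norm_square[of a]
        by (simp add: ip_scale_right mem w sH tH mult.commute flip: a_def)
      also have "(ip_norm ip ?v)\<^sup>2 = r\<^sup>2 * (cmod a)\<^sup>2 * N"
        using \<open>r > 0\<close> by (simp add: ip_norm_scale tH N_def norm_mult power_mult_distrib)
      finally have "r * (cmod a)\<^sup>2 * (2 - r * N) < inverse (real (Suc n))"
        using s_lt[of n] by (simp add: algebra_simps power2_eq_square)
      moreover have "r * (cmod a)\<^sup>2 * 1 \<le> r * (cmod a)\<^sup>2 * (2 - r * N)"
        using rN by (intro mult_left_mono) (auto simp: algebra_simps)
      ultimately have "r * (cmod a)\<^sup>2 \<le> inverse (real (Suc n))" by simp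
      then have "(N + 1) * (r * (cmod a)\<^sup>2) \<le> (N + 1) * inverse (real (Suc n))"
        using N0 by (intro mult_left_mono) auto
      moreover have "(N + 1) * (r * (cmod a)\<^sup>2) = (cmod a)\<^sup>2"
        using rN(1) by (metis mult.assoc mult.commute mult_1)
      ultimately show ?thesis unfolding a_def by linarith
    qed
    have "(\<lambda>n. (cmod (ip (w - s n) t))\<^sup>2) \<longlonglongrightarrow> 0"
    proof (rule Lim_null_comparison)
      show "(\<lambda>n. (N + 1) * inverse (real (Suc n))) \<longlonglongrightarrow> 0"
        using tendsto_mult_right_zero[OF LIMSEQ_inverse_real_of_nat] .
    qed (use bound in simp)
    moreover have "(\<lambda>n. (cmod (ip (w - s n) t))\<^sup>2) \<longlonglongrightarrow> (cmod (ip (w - l) t))\<^sup>2"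
      using tendsto_ip_left[OF sH l tH lim]
      by (auto intro!: tendsto_intros simp: ip_diff_left w sH l tH)
    ultimately show "ip (w - l) t = 0"
      using LIMSEQ_unique by fastforce
  qed (simp add: w l mem)
  then show ?thesis using sS lim by auto
qed

end

section \<open>Direct sums and orthogonal complements\<close>

lemma cinner_space_dsum:
  assumes "cinner_space s1 H1 ip1" and "cinner_space s2 H2 ip2"
  shows "cinner_space (dsum_scale s1 s2) (H1 \<times> H2) (dsum_ip ip1 ip2)"
proof -
  interpret A: cinner_space s1 H1 ip1 by fact
  interpret B: cinner_space s2 H2 ip2 by fact
  interpret V: vector_space "dsum_scale s1 s2"
    by unfold_locales
      (simp_all add: dsum_scale_def A.scale_right_distrib A.scale_left_distrib
        B.scale_right_distrib B.scale_left_distrib)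
  show ?thesis
  proof unfold_locales
    show "V.subspace (H1 \<times> H2)"
      by (auto simp: V.subspace_def A.mem B.mem dsum_scale_def zero_prod_def)
  next
    fix f assume f: "f \<in> H1 \<times> H2" and 0: "dsum_ip ip1 ip2 f f = 0"
    have "ip1 (fst f) (fst f) = 0 \<and> ip2 (snd f) (snd f) = 0"
      using A.ip_nonneg[of "fst f"] B.ip_nonneg[of "snd f"] f 0
      by (auto simp: dsum_ip_def complex_nonneg_Reals_iff complex_eq_iff)
    then show "f = 0"
      using A.ip_definite[of "fst f"] B.ip_definite[of "snd f"] f by (auto simp: prod_eq_iff)
  next
    fix f assume "f \<in> H1 \<times> H2"
    then show "dsum_ip ip1 ip2 f f \<in> \<real>\<^sub>\<ge>\<^sub>0"
      using A.ip_nonneg[of "fst f"] B.ip_nonneg[of "snd f"] by (auto simp: dsum_ip_def)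
  next
    fix f g assume "f \<in> H1 \<times> H2" "g \<in> H1 \<times> H2"
    then show "dsum_ip ip1 ip2 g f = cnj (dsum_ip ip1 ip2 f g)"
      using A.ip_commute[of "fst f" "fst g"] B.ip_commute[of "snd f" "snd g"]
      by (auto simp: dsum_ip_def)
  qed (auto simp: dsum_ip_def dsum_scale_def A.ip_bilinear B.ip_bilinear algebra_simps)
qed

lemma chilbert_space_dsum:
  assumes "chilbert_space s1 H1 ip1" and "chilbert_space s2 H2 ip2"
  shows "chilbert_space (dsum_scale s1 s2) (H1 \<times> H2) (dsum_ip ip1 ip2)"
proof -
  interpret A: chilbert_space s1 H1 ip1 by fact
  interpret B: chilbert_space s2 H2 ip2 by fact
  interpret P: cinner_space "dsum_scale s1 s2" "H1 \<times> H2" "dsum_ip ip1 ip2"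
    by (rule cinner_space_dsum) unfold_locales
  have norm_sq: "ip_norm (dsum_ip ip1 ip2) p = sqrt ((ip_norm ip1 (fst p))\<^sup>2 + (ip_norm ip2 (snd p))\<^sup>2)"
    if "p \<in> H1 \<times> H2" for p
    using that by (auto simp: ip_norm_def[of "dsum_ip ip1 ip2"] dsum_ip_def A.ip_norm_sq B.ip_norm_sq)
  show ?thesis
  proof unfold_locales
    fix s :: "nat \<Rightarrow> 'a \<times> 'b"
    assume s: "\<And>n. s n \<in> H1 \<times> H2"
      and cauchy: "\<And>e. e > 0 \<Longrightarrow> \<exists>N. \<forall>m\<ge>N. \<forall>n\<ge>N. ip_norm (dsum_ip ip1 ip2) (s m - s n) < e"
    have s1: "fst (s n) \<in> H1" and s2: "snd (s n) \<in> H2" for n using s[of n] by auto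
    have le: "ip_norm ip1 (fst (s m) - fst (s n)) \<le> ip_norm (dsum_ip ip1 ip2) (s m - s n)"
      "ip_norm ip2 (snd (s m) - snd (s n)) \<le> ip_norm (dsum_ip ip1 ip2) (s m - s n)" for m n
      using s1[of m] s1[of n] s2[of m] s2[of n]
      by (simp_all add: norm_sq s P.mem A.ip_norm_nonneg A.mem B.ip_norm_nonneg B.mem real_le_rsqrt)
    obtain l1 where l1: "l1 \<in> H1" "(\<lambda>n. ip_norm ip1 (fst (s n) - l1)) \<longlonglongrightarrow> 0"
      using A.complete[of "\<lambda>n. fst (s n)", OF s1] cauchy le(1) by (meson order_le_less_trans)
    obtain l2 where l2: "l2 \<in> H2" "(\<lambda>n. ip_norm ip2 (snd (s n) - l2)) \<longlonglongrightarrow> 0"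
      using B.complete[of "\<lambda>n. snd (s n)", OF s2] cauchy le(2) by (meson order_le_less_trans)
    have "(\<lambda>n. sqrt ((ip_norm ip1 (fst (s n) - l1))\<^sup>2 + (ip_norm ip2 (snd (s n) - l2))\<^sup>2)) \<longlonglongrightarrow> sqrt (0\<^sup>2 + 0\<^sup>2)"
      by (intro tendsto_intros l1 l2)
    moreover have "ip_norm (dsum_ip ip1 ip2) (s n - (l1, l2))
        = sqrt ((ip_norm ip1 (fst (s n) - l1))\<^sup>2 + (ip_norm ip2 (snd (s n) - l2))\<^sup>2)" for n
      using norm_sq[of "s n - (l1, l2)"] s l1 l2 by (simp add: P.mem)
    ultimately show "\<exists>l\<in>H1 \<times> H2. (\<lambda>n. ip_norm (dsum_ip ip1 ip2) (s n - l)) \<longlonglongrightarrow> 0"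
      using l1 l2 by (intro bexI[of _ "(l1, l2)"]) auto
  qed
qed

text \<open>Inner products with a fixed element of \<open>M\<close> are continuous, so the limit of
  a sequence in the complement stays there and completeness is inherited.\<close>

lemma (in chilbert_space) chilbert_space_ortho_compl:
  assumes M: "M \<subseteq> H"
  shows "chilbert_space scale (ortho_compl H ip M) ip"
proof unfold_locales
  show "subspace (ortho_compl H ip M)"
    using M by (auto simp: subspace_def ortho_compl_def mem ip_bilinear ip_zero_left subset_iff)
next
  fix s :: "nat \<Rightarrow> 'a"
  assume s: "\<And>n. s n \<in> ortho_compl H ip M"
    and cauchy: "\<And>e. e > 0 \<Longrightarrow> \<exists>N. \<forall>m\<ge>N. \<forall>n\<ge>N. ip_norm ip (s m - s n) < e"
  have sH: "s n \<in> H" for n using s by (auto simp: ortho_compl_def)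
  obtain l where l: "l \<in> H" "(\<lambda>n. ip_norm ip (s n - l)) \<longlonglongrightarrow> 0"
    using complete[of s, OF sH cauchy] by blast
  have "ip l m = 0" if m: "m \<in> M" for m
  proof -
    have "(\<lambda>n. ip (s n) m) \<longlonglongrightarrow> ip l m"
      by (rule tendsto_ip_left[OF sH l(1) _ l(2)]) (use m M in blast)
    moreover have "(\<lambda>n. ip (s n) m) = (\<lambda>_. 0)"
      using s m by (auto simp: ortho_compl_def)
    ultimately show ?thesis by (simp add: LIMSEQ_const_iff)
  qed
  with l show "\<exists>l\<in>ortho_compl H ip M. (\<lambda>n. ip_norm ip (s n - l)) \<longlonglongrightarrow> 0"
    by (auto simp: ortho_compl_def)
qed (auto simp: ortho_compl_def ip_bilinear ip_nonneg ip_definite intro: ip_commute)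

section \<open>Hilbert spaces determined by a Gram matrix\<close>

text \<open>Equal Gram matrices make \<open>p1 y \<mapsto> p2 y\<close> extend to an isometry on the
  closed span of the first family, which is all of \<open>H1\<close> by totality; \<open>v\<close>
  is the image of \<open>w\<close>. It serves twice, with the roles of the spaces exchanged, once
  for the range of a map and once for its surjectivity.\<close>

lemma same_Gram_transfer:
  assumes H1: "chilbert_space s1 H1 ip1" and H2: "chilbert_space s2 H2 ip2"
    and p1: "\<And>y. p1 y \<in> H1" and p2: "\<And>y. p2 y \<in> H2"
    and total: "\<And>w. w \<in> H1 \<Longrightarrow> (\<And>y. ip1 w (p1 y) = 0) \<Longrightarrow> w = 0"
    and gram: "\<And>x y. ip1 (p1 x) (p1 y) = ip2 (p2 x) (p2 y)"
    and w: "w \<in> H1"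
  shows "\<exists>v\<in>H2. (\<forall>y. ip2 v (p2 y) = ip1 w (p1 y)) \<and> ip2 v v = ip1 w w"
proof -
  interpret A: chilbert_space s1 H1 ip1 by fact
  interpret B: chilbert_space s2 H2 ip2 by fact
  interpret P: cinner_space "dsum_scale s1 s2" "H1 \<times> H2" "dsum_ip ip1 ip2"
    by (rule cinner_space_dsum) unfold_locales
  \<comment> \<open>The span of the pairs is the graph of the isometry that matches the two families.\<close>
  define R where "R = P.span (range (\<lambda>y. (p1 y, p2 y)))"
  have R_sub: "P.subspace R" by (simp add: R_def)
  have pR: "(p1 y, p2 y) \<in> R" for y by (auto simp: R_def intro: P.span_base)
  \<comment> \<open>The Gram identity is extended to the span one slot at a time: here in the left
    argument, and in \<open>R2\<close> in the right one, where this fact supplies the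
    generators.\<close>
  have R1: "q \<in> H1 \<times> H2 \<and> (\<forall>y. ip1 (fst q) (p1 y) = ip2 (snd q) (p2 y))" if "q \<in> R" for q
    using that unfolding R_def
  proof (rule P.span_induct)
    show "P.subspace {q. q \<in> H1 \<times> H2 \<and> (\<forall>y. ip1 (fst q) (p1 y) = ip2 (snd q) (p2 y))}"
      by (auto simp: P.subspace_def dsum_scale_def zero_prod_def A.mem B.mem p1 p2
          A.ip_bilinear B.ip_bilinear A.ip_zero_left B.ip_zero_left)
  qed (auto simp: p1 p2 gram)
  have R2: "ip1 (fst q) (fst q') = ip2 (snd q) (snd q')" if q: "q \<in> R" and q': "q' \<in> R" for q q'
  proof -
    have qH: "fst q \<in> H1" "snd q \<in> H2" using R1[OF q] by auto
    have "q' \<in> H1 \<times> H2 \<and> ip1 (fst q) (fst q') = ip2 (snd q) (snd q')"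
      using q' unfolding R_def
    proof (rule P.span_induct)
      show "P.subspace {q'. q' \<in> H1 \<times> H2 \<and> ip1 (fst q) (fst q') = ip2 (snd q) (snd q')}"
        using qH by (auto simp: P.subspace_def dsum_scale_def zero_prod_def A.mem B.mem
            A.ip_bilinear B.ip_bilinear A.ip_zero_right B.ip_zero_right)
    qed (use p1 p2 R1[OF q] in auto)
    then show ?thesis by blast
  qed
  have S_sub: "A.subspace (fst ` R)"
  proof (rule A.subspaceI)
    show "0 \<in> fst ` R" using P.subspace_0[OF R_sub] by force
    show "x + y \<in> fst ` R" if "x \<in> fst ` R" "y \<in> fst ` R" for x y
      using that P.subspace_add[OF R_sub] by (metis (no_types, lifting) fst_add imageE imageI)
    show "s1 c x \<in> fst ` R" if x: "x \<in> fst ` R" for c x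
    proof -
      obtain q where "q \<in> R" "x = fst q" using x by blast
      then show ?thesis
        using P.subspace_scale[OF R_sub, of q c] by (force simp: dsum_scale_def)
    qed
  qed
  have "\<exists>a. (\<forall>n::nat. a n \<in> fst ` R) \<and> (\<lambda>n. ip_norm ip1 (a n - w)) \<longlonglongrightarrow> 0"
  proof (rule A.total_subspace_dense[OF S_sub _ _ w])
    show "fst ` R \<subseteq> H1" using R1 by auto
    show "u = 0" if "u \<in> H1" "\<And>s. s \<in> fst ` R \<Longrightarrow> ip1 u s = 0" for u
      using total[OF that(1)] that(2) pR by force
  qed
  then obtain a where a: "\<And>n::nat. a n \<in> fst ` R" and lim_a: "(\<lambda>n. ip_norm ip1 (a n - w)) \<longlonglongrightarrow> 0"
    by blast
  have "\<forall>n. \<exists>q. q \<in> R \<and> fst q = a n" using a by fastforce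
  then obtain q where q: "\<And>n. q n \<in> R" and fst_q: "\<And>n. fst (q n) = a n" by metis
  define b where "b n = snd (q n)" for n
  have aH: "a n \<in> H1" and bH: "b n \<in> H2" for n
    using R1[OF q[of n]] fst_q[of n] by (auto simp: b_def)
  have norm_b: "ip_norm ip2 (b n) = ip_norm ip1 (a n)" for n
    using R2[OF q[of n] q[of n]] by (simp add: ip_norm_def b_def fst_q)
  \<comment> \<open>Differences of elements of \<open>R\<close> are in \<open>R\<close>, so the
    second components have the same mutual distances as the first ones. This makes \<open>b\<close>
    Cauchy and yields the image of \<open>w\<close> as its limit.\<close>
  have norm_diff: "ip_norm ip2 (b m - b n) = ip_norm ip1 (a m - a n)" for m n
    using R2[OF P.subspace_diff[OF R_sub q[of m] q[of n]] P.subspace_diff[OF R_sub q[of m] q[of n]]]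
    by (simp add: ip_norm_def b_def fst_q)
  have "\<exists>N. \<forall>m\<ge>N. \<forall>n\<ge>N. ip_norm ip2 (b m - b n) < e" if "e > 0" for e
    unfolding norm_diff by (rule A.convergent_imp_Cauchy[OF aH w lim_a that])
  then obtain v where v: "v \<in> H2" and lim_b: "(\<lambda>n. ip_norm ip2 (b n - v)) \<longlonglongrightarrow> 0"
    using B.complete[of b, OF bH] by blast
  have "ip2 v (p2 y) = ip1 w (p1 y)" for y
  proof -
    have "ip1 (a n) (p1 y) = ip2 (b n) (p2 y)" for n
      using R1[OF q[of n]] by (simp add: fst_q b_def)
    then show ?thesis
      using A.tendsto_ip_left[OF aH w p1[of y] lim_a] B.tendsto_ip_left[OF bH v p2[of y] lim_b]
        LIMSEQ_unique by auto
  qed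
  moreover have "ip_norm ip2 v = ip_norm ip1 w"
    using A.tendsto_ip_norm[OF aH w lim_a] B.tendsto_ip_norm[OF bH v lim_b] LIMSEQ_unique
    by (auto simp: norm_b)
  then have "ip2 v v = ip1 w w" using v w by (simp add: A.ip_self B.ip_self)
  ultimately show ?thesis using v by blast
qed

text \<open>The vector \<open>p y\<close> represents evaluation at \<open>y\<close> through
  \<open>J\<close>, and \<open>J\<close> sends it to the kernel function at \<open>y\<close>. Both
  families therefore have the Gram entries \<open>K y x\<close>. That \<open>J\<close> maps into
  \<open>H\<close> is a conclusion, not an assumption.\<close>

lemma unitary_onto_hilbert_function_space:
  assumes W: "chilbert_space sW W ipW" and HK: "is_hilbert_function_space K H ip"
    and lin: "clinear_on sW fun_scale W J" and inj: "inj_on J W"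
    and p: "\<And>y. p y \<in> W" and J_eval: "\<And>w y. w \<in> W \<Longrightarrow> J w y = ipW w (p y)"
    and J_p: "\<And>x y. J (p y) x = K x y"
  shows "unitary_between sW W ipW fun_scale H ip J"
proof -
  interpret W: chilbert_space sW W ipW by fact
  interpret H: chilbert_space fun_scale H ip using HK by (simp add: is_hilbert_function_space_def)
  have K: "(\<lambda>x. K x y) \<in> H" for y using HK by (simp add: is_hilbert_function_space_def)
  have eval: "f y = ip f (\<lambda>x. K x y)" if "f \<in> H" for f y
    using HK that by (simp add: is_hilbert_function_space_def)
  have gram: "ipW (p x) (p y) = ip (\<lambda>z. K z x) (\<lambda>z. K z y)" for x y
    using J_eval[OF p, of x y] J_p[where x = y and y = x] eval[OF K[of x], of y] by simp
  have "J 0 = 0"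
    using lin W.zero_mem unfolding clinear_on_def by (metis add_cancel_right_right)
  \<comment> \<open>A vector orthogonal to every \<open>p y\<close> has all values of
    \<open>J w\<close> equal to zero, so injectivity of \<open>J\<close> is exactly totality of the
    family.\<close>
  then have total_W: "w = 0" if "w \<in> W" "\<And>y. ipW w (p y) = 0" for w
    using that inj W.zero_mem J_eval[OF that(1)]
    by (metis (no_types, lifting) ext inj_onD zero_fun_apply)
  \<comment> \<open>The transferred vector \<open>v\<close> has the same point values as
    \<open>J w\<close>. Functions are determined by their values, so \<open>v\<close> is
    \<open>J w\<close>.\<close>
  have into: "J w \<in> H \<and> ip (J w) (J w) = ipW w w" if w: "w \<in> W" for w
  proof -
    obtain v where v: "v \<in> H" "\<And>y. ip v (\<lambda>x. K x y) = ipW w (p y)" "ip v v = ipW w w"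
      using same_Gram_transfer[where ?p1.0 = p and ?p2.0 = "\<lambda>y x. K x y", OF W H.chilbert_space_axioms p K total_W gram w] by blast
    have "v = J w" using eval[OF v(1)] v(2) J_eval[OF w] by auto
    with v show ?thesis by simp
  qed
  have onto: "f \<in> J ` W" if f: "f \<in> H" for f
  proof -
    have "g = 0" if "g \<in> H" "\<And>y. ip g (\<lambda>x. K x y) = 0" for g
      using eval[OF that(1)] that(2) by auto
    from same_Gram_transfer[where ?p1.0 = "\<lambda>y x. K x y" and ?p2.0 = p, OF H.chilbert_space_axioms W K p this gram[symmetric] f]
    obtain w where w: "w \<in> W" "\<And>y. ipW w (p y) = ip f (\<lambda>x. K x y)" by blast
    have "J w = f" using eval[OF f] w(2) J_eval[OF w(1)] by auto
    with w show ?thesis by blast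
  qed
  have "ip (J f) (J g) = ipW f g" if "f \<in> W" "g \<in> W" for f g
    by (rule isometry_preserves_ip[OF W.cinner_space_axioms H.cinner_space_axioms lin])
      (use into that in auto)
  moreover have "J ` W = H" using into onto by auto
  ultimately show ?thesis
    using lin inj by (auto simp: unitary_between_def bij_betw_def)
qed

section \<open>The tensor product with \<open>\<ell>\<^sup>2\<close> and row multipliers\<close>

text \<open>Cauchy-Schwarz in each component bounds the terms by a sum of two summable squares.
  Since \<open>suminf\<close> is total, this convergence has to be known before the inner product
  can be shown to be additive.\<close>

lemma summable_tensor_l2_ip:
  assumes H: "cinner_space fun_scale H ip"
    and f: "f \<in> tensor_l2 H ip" and g: "g \<in> tensor_l2 H ip"
  shows "summable (\<lambda>j. ip (\<lambda>x. f x j) (\<lambda>x. g x j))"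
proof (rule summable_comparison_test')
  interpret cinner_space fun_scale H ip by fact
  let ?nf = "\<lambda>j. ip_norm ip (\<lambda>x. f x j)" and ?ng = "\<lambda>j. ip_norm ip (\<lambda>x. g x j)"
  show "summable (\<lambda>j. (?nf j)\<^sup>2 + (?ng j)\<^sup>2)"
    using f g by (auto simp: tensor_l2_def intro: summable_add)
  show "norm (ip (\<lambda>x. f x j) (\<lambda>x. g x j)) \<le> (?nf j)\<^sup>2 + (?ng j)\<^sup>2" if "j \<ge> 0" for j
  proof -
    have "norm (ip (\<lambda>x. f x j) (\<lambda>x. g x j)) \<le> ?nf j * ?ng j"
      using f g by (intro Cauchy_Schwarz) (auto simp: tensor_l2_def)
    also have "\<dots> \<le> (?nf j)\<^sup>2 + (?ng j)\<^sup>2"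
      using sum_squares_bound[of "?nf j" "?ng j"] zero_le_power2[of "?nf j"] zero_le_power2[of "?ng j"]
      by linarith
    finally show ?thesis .
  qed
qed

lemma cinner_space_tensor_l2:
  assumes H: "cinner_space fun_scale H ip"
  shows "cinner_space tensor_l2_scale (tensor_l2 H ip) (tensor_l2_ip ip)"
proof -
  interpret cinner_space fun_scale H ip by fact
  interpret V: vector_space "tensor_l2_scale :: complex \<Rightarrow> ('a \<Rightarrow> nat \<Rightarrow> complex) \<Rightarrow> _"
    by unfold_locales (auto simp: tensor_l2_scale_def algebra_simps fun_eq_iff)
  have comp_add: "(\<lambda>x. (f + g) x j) = (\<lambda>x. f x j) + (\<lambda>x. g x j)"
    and comp_scale: "(\<lambda>x. tensor_l2_scale c f x j) = fun_scale c (\<lambda>x. f x j)"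
    for f g :: "'a \<Rightarrow> nat \<Rightarrow> complex" and c j
    by (auto simp: tensor_l2_scale_def fun_scale_def)
  have comp: "(\<lambda>x. f x j) \<in> H" if "f \<in> tensor_l2 H ip" for f j
    using that by (simp add: tensor_l2_def)
  have self: "tensor_l2_ip ip f f = complex_of_real (\<Sum>j. (ip_norm ip (\<lambda>x. f x j))\<^sup>2)"
    if "f \<in> tensor_l2 H ip" for f
    unfolding tensor_l2_ip_def ip_self[OF comp[OF that]]
    by (rule suminf_of_real[symmetric]) (use that in \<open>simp add: tensor_l2_def\<close>)
  show ?thesis
  proof unfold_locales
    show "V.subspace (tensor_l2 H ip)"
    proof (rule V.subspaceI)
      have "(\<lambda>x. 0) \<in> H" using zero_mem by (simp add: zero_fun_def)
      then show "0 \<in> tensor_l2 H ip"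
        using ip_norm_eq_0[OF zero_mem] by (simp add: tensor_l2_def zero_fun_def)
    next
      fix f g assume f: "f \<in> tensor_l2 H ip" and g: "g \<in> tensor_l2 H ip"
      have "summable (\<lambda>j. (ip_norm ip (\<lambda>x. (f + g) x j))\<^sup>2)"
      proof (rule summable_comparison_test')
        show "summable (\<lambda>j. 2 * (ip_norm ip (\<lambda>x. f x j))\<^sup>2 + 2 * (ip_norm ip (\<lambda>x. g x j))\<^sup>2)"
          using f g by (auto simp: tensor_l2_def intro!: summable_add summable_mult)
        fix j :: nat
        let ?f = "\<lambda>x. f x j" and ?g = "\<lambda>x. g x j"
        \<comment> \<open>The parallelogram law with the squared norm of the difference
          dropped.\<close>
        have "(ip_norm ip (?f + ?g))\<^sup>2 \<le> 2 * (ip_norm ip ?f)\<^sup>2 + 2 * (ip_norm ip ?g)\<^sup>2"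
          using ip_norm_add_sq[OF comp[OF f, of j] comp[OF g, of j]]
            ip_norm_diff_sq[OF comp[OF f, of j] comp[OF g, of j]]
            zero_le_power2[of "ip_norm ip (?f - ?g)"] by linarith
        then show "norm ((ip_norm ip (\<lambda>x. (f + g) x j))\<^sup>2)
            \<le> 2 * (ip_norm ip ?f)\<^sup>2 + 2 * (ip_norm ip ?g)\<^sup>2"
          unfolding comp_add by simp
      qed
      then show "f + g \<in> tensor_l2 H ip"
        using comp[OF f] comp[OF g] by (simp only: tensor_l2_def mem_Collect_eq comp_add add_mem) simp
    next
      fix c f assume f: "f \<in> tensor_l2 H ip"
      then show "tensor_l2_scale c f \<in> tensor_l2 H ip"
        by (simp add: tensor_l2_def comp_scale scale_mem ip_norm_scale power_mult_distrib summable_mult)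
    qed
  next
    fix f g h assume "f \<in> tensor_l2 H ip" "g \<in> tensor_l2 H ip" "h \<in> tensor_l2 H ip"
    then show "tensor_l2_ip ip (f + g) h = tensor_l2_ip ip f h + tensor_l2_ip ip g h"
      unfolding tensor_l2_ip_def comp_add
      by (simp only: ip_add_left comp suminf_add summable_tensor_l2_ip[OF H])
  next
    fix f g c assume "f \<in> tensor_l2 H ip" "g \<in> tensor_l2 H ip"
    then show "tensor_l2_ip ip (tensor_l2_scale c f) g = c * tensor_l2_ip ip f g"
      unfolding tensor_l2_ip_def comp_scale
      by (simp only: ip_scale_left comp suminf_mult summable_tensor_l2_ip[OF H])
  next
    fix f g assume f: "f \<in> tensor_l2 H ip" and g: "g \<in> tensor_l2 H ip"
    have "(\<lambda>j. cnj (ip (\<lambda>x. f x j) (\<lambda>x. g x j))) sums cnj (tensor_l2_ip ip f g)"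
      unfolding sums_cnj tensor_l2_ip_def
      by (rule summable_sums[OF summable_tensor_l2_ip[OF H f g]])
    then show "tensor_l2_ip ip g f = cnj (tensor_l2_ip ip f g)"
      unfolding tensor_l2_ip_def[of ip g f]
      using comp[OF f] comp[OF g] by (simp add: ip_commute[OF comp[OF f] comp[OF g]] sums_iff)
  next
    fix f assume f: "f \<in> tensor_l2 H ip"
    show "tensor_l2_ip ip f f \<in> \<real>\<^sub>\<ge>\<^sub>0"
      unfolding self[OF f] using f by (auto simp: tensor_l2_def intro!: suminf_nonneg)
  next
    fix f assume f: "f \<in> tensor_l2 H ip" and 0: "tensor_l2_ip ip f f = 0"
    have "(ip_norm ip (\<lambda>x. f x j))\<^sup>2 = 0" for j
      using 0 f unfolding self[OF f] by (subst (asm) of_real_eq_0_iff, subst (asm) suminf_eq_zero_iff)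
        (auto simp: tensor_l2_def)
    then have "(\<lambda>x. f x j) = 0" for j using ip_norm_eq_0[OF comp[OF f]] by simp
    then show "f = 0" by (simp add: fun_eq_iff)
  qed
qed

text \<open>The elementary tensor of \<open>g\<close> with the \<open>j\<close>-th standard basis
  vector.\<close>

definition tensor_single :: "nat \<Rightarrow> ('x \<Rightarrow> complex) \<Rightarrow> 'x \<Rightarrow> nat \<Rightarrow> complex" where
  "tensor_single j g = (\<lambda>x i. if i = j then g x else 0)"

lemma tensor_single_component:
  "(\<lambda>x. tensor_single j g x i) = (if i = j then g else 0)"
  by (auto simp: tensor_single_def)

lemma tensor_single_mem:
  assumes "cinner_space fun_scale H ip" and g: "g \<in> H"
  shows "tensor_single j g \<in> tensor_l2 H ip"
proof -
  interpret cinner_space fun_scale H ip by fact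
  have "summable (\<lambda>i. (ip_norm ip (if i = j then g else 0))\<^sup>2)"
    by (rule summable_finite[of "{j}"]) (auto simp: ip_norm_eq_0 zero_mem)
  then show ?thesis using g zero_mem by (simp add: tensor_l2_def tensor_single_component)
qed

lemma tensor_single_ip:
  assumes "cinner_space fun_scale H ip" and h: "h \<in> tensor_l2 H ip"
  shows "tensor_l2_ip ip (tensor_single j g) h = ip g (\<lambda>x. h x j)"
proof -
  interpret cinner_space fun_scale H ip by fact
  have "tensor_l2_ip ip (tensor_single j g) h
      = (\<Sum>i\<in>{j}. ip (if i = j then g else 0) (\<lambda>x. h x i))"
    unfolding tensor_l2_ip_def tensor_single_component
    by (rule suminf_finite) (use h in \<open>auto simp: ip_zero_left tensor_l2_def\<close>)
  then show ?thesis by simp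
qed

lemma mult_op_tensor_single: "mult_op b (tensor_single j g) y = b y j * g y"
proof -
  have "mult_op b (tensor_single j g) y = (\<Sum>i\<in>{j}. b y i * tensor_single j g y i)"
    unfolding mult_op_def by (rule suminf_finite) (auto simp: tensor_single_def)
  then show ?thesis by (simp add: tensor_single_def)
qed

lemma clinear_mult_op:
  assumes "row_multiplier H ip b"
  shows "clinear_on tensor_l2_scale fun_scale (tensor_l2 H ip) (mult_op b)"
  using assms
  by (auto simp: clinear_on_def row_multiplier_def mult_op_def tensor_l2_scale_def fun_scale_def
      fun_eq_iff distrib_left suminf_add mult.left_commute[of _ c for c :: complex] suminf_mult)

text \<open>The classical formula for the adjoint of a multiplication operator at a kernel function.
  Testing against elementary tensors gives it one coordinate at a time, so no square summability of
  the values \<open>b y j\<close> enters.\<close>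

lemma adjoint_kernel_component:
  assumes Hk: "is_hilbert_function_space k H ip" and b: "row_multiplier H ip b"
    and adj: "is_adjoint (tensor_l2 H ip) (tensor_l2_ip ip) H ip (mult_op b) A"
  shows "A (\<lambda>x. k x y) x j = cnj (b y j) * k x y"
proof -
  interpret chilbert_space fun_scale H ip using Hk by (simp add: is_hilbert_function_space_def)
  let ?k = "\<lambda>x. k x y" and ?a = "\<lambda>x. A (\<lambda>x. k x y) x j"
  have k: "?k \<in> H" using Hk by (simp add: is_hilbert_function_space_def)
  have eval: "f y = ip f ?k" if "f \<in> H" for f
    using Hk that by (simp add: is_hilbert_function_space_def)
  have A: "A ?k \<in> tensor_l2 H ip" using adj k by (auto simp: is_adjoint_def)
  then have a: "?a \<in> H" by (simp add: tensor_l2_def)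
  \<comment> \<open>The test vector is built from the difference of the two sides, so equality of
    its inner products with them gives \<open>ip ?d ?d = 0\<close> at once.\<close>
  let ?d = "?a - fun_scale (cnj (b y j)) ?k"
  have d: "?d \<in> H" using a k by (simp add: mem)
  let ?e = "tensor_single j ?d"
  have e: "?e \<in> tensor_l2 H ip" by (rule tensor_single_mem[OF cinner_space_axioms d])
  have "ip ?d ?a = tensor_l2_ip ip ?e (A ?k)"
    by (rule tensor_single_ip[OF cinner_space_axioms A, symmetric])
  also have "\<dots> = ip (mult_op b ?e) ?k" using adj e k by (simp add: is_adjoint_def)
  also have "\<dots> = ip ?d (fun_scale (cnj (b y j)) ?k)"
  proof -
    have "mult_op b ?e \<in> H" using b e by (simp add: row_multiplier_def)
    then have "ip (mult_op b ?e) ?k = b y j * ?d y"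
      using eval mult_op_tensor_single by metis
    also have "?d y = ip ?d ?k" using eval[OF d] .
    also have "b y j * ip ?d ?k = ip ?d (fun_scale (cnj (b y j)) ?k)"
      using d k by (simp add: ip_scale_right)
    finally show ?thesis .
  qed
  finally have "ip ?d ?d = 0"
    using ip_diff_right[OF a scale_mem[OF k] d] by simp
  then have "?d = 0" by (rule ip_definite[OF d])
  from fun_cong[OF this, of x] show ?thesis by (simp add: fun_scale_def)
qed

section \<open>The complement of the graph\<close>

theorem theorem5:
  fixes k :: "'x \<Rightarrow> 'x \<Rightarrow> complex"
    and Hk :: "('x \<Rightarrow> complex) set"
    and ipk :: "('x \<Rightarrow> complex) \<Rightarrow> ('x \<Rightarrow> complex) \<Rightarrow> complex"
    and b :: "'x \<Rightarrow> nat \<Rightarrow> complex"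
    and Mb_adj :: "('x \<Rightarrow> complex) \<Rightarrow> 'x \<Rightarrow> nat \<Rightarrow> complex"
    and \<Delta> :: "('x \<Rightarrow> nat \<Rightarrow> complex) \<Rightarrow> 'x \<Rightarrow> nat \<Rightarrow> complex"
    and scaleL :: "complex \<Rightarrow> 'l::ab_group_add \<Rightarrow> 'l"
    and L :: "'l set"
    and ipL :: "'l \<Rightarrow> 'l \<Rightarrow> complex"
    and \<iota> :: "('x \<Rightarrow> nat \<Rightarrow> complex) \<Rightarrow> 'l"
    and Hb :: "('x \<Rightarrow> complex) set"
    and ipb :: "('x \<Rightarrow> complex) \<Rightarrow> ('x \<Rightarrow> complex) \<Rightarrow> complex"
  defines "T \<equiv> tensor_l2 Hk ipk"
    and "ipT \<equiv> tensor_l2_ip ipk"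
  defines "Mperp \<equiv> ortho_compl (Hk \<times> L) (dsum_ip ipk ipL) (graph_space b T \<iota>)"
  assumes kernel: "reproducing_kernel k"
    and Hk: "is_hilbert_function_space k Hk ipk"
    and multiplier: "row_multiplier Hk ipk b"
    and contractive: "opnorm_le T ipT ipk (mult_op b) 1"
    and adjoint: "is_adjoint T ipT Hk ipk (mult_op b) Mb_adj"
    and Delta: "is_pos_sqrt tensor_l2_scale T ipT (\<lambda>f. f - Mb_adj (mult_op b f)) \<Delta>"
    and Delta_inj: "inj_on \<Delta> T"
    and L_Delta: "is_hilbert_completion tensor_l2_scale T (\<lambda>f. ip_norm ipT (\<Delta> f)) scaleL L ipL \<iota>"
    and Hb: "is_hilbert_function_space (mult_kernel k b) Hb ipb"
  shows "unitary_between (dsum_scale fun_scale scaleL) Mperp (dsum_ip ipk ipL) fun_scale Hb ipb fst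
    \<and> (\<forall>f\<in>Hb. (\<exists>!g. g \<in> L \<and> (f, g) \<in> Mperp) \<and>
        (\<forall>g. (f, g) \<in> Mperp \<longrightarrow>
          (ip_norm ipb f)\<^sup>2 = (ip_norm ipk f)\<^sup>2 + (ip_norm ipL g)\<^sup>2))"
proof -
  interpret H: chilbert_space fun_scale Hk ipk using Hk by (simp add: is_hilbert_function_space_def)
  interpret T: cinner_space tensor_l2_scale T ipT
    unfolding T_def ipT_def by (rule cinner_space_tensor_l2) unfold_locales
  interpret L: chilbert_space scaleL L ipL using L_Delta by (simp add: is_hilbert_completion_def)
  interpret P: chilbert_space "dsum_scale fun_scale scaleL" "Hk \<times> L" "dsum_ip ipk ipL"
    by (rule chilbert_space_dsum) unfold_locales
  define V where "V f = (mult_op b f, \<iota> f)" for f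
  have kH: "(\<lambda>x. k x y) \<in> Hk" for y using Hk by (simp add: is_hilbert_function_space_def)
  have eval: "f y = ipk f (\<lambda>x. k x y)" if "f \<in> Hk" for f y
    using Hk that by (simp add: is_hilbert_function_space_def)
  have M_mem: "mult_op b f \<in> Hk" if "f \<in> T" for f
    using multiplier that by (simp add: row_multiplier_def T_def)
  have adj_mem: "Mb_adj h \<in> T" if "h \<in> Hk" for h using adjoint that by (auto simp: is_adjoint_def)
  have adj_eq: "ipk (mult_op b f) h = ipT f (Mb_adj h)" if "f \<in> T" "h \<in> Hk" for f h
    using adjoint that by (simp add: is_adjoint_def)
  have \<iota>_mem: "\<iota> f \<in> L" if "f \<in> T" for f using L_Delta that by (auto simp: is_hilbert_completion_def)
  have V_mem: "V f \<in> Hk \<times> L" if "f \<in> T" for f using that by (simp add: V_def M_mem \<iota>_mem)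
  have V_lin: "clinear_on tensor_l2_scale (dsum_scale fun_scale scaleL) T V"
    using clinear_mult_op[OF multiplier] L_Delta
    by (simp add: V_def clinear_on_def dsum_scale_def is_hilbert_completion_def T_def)
  \<comment> \<open>The norm of \<open>\<iota> f\<close> is that of \<open>\<Delta> f\<close>, whose
    square is the squared norm of \<open>f\<close> minus that of \<open>mult_op b f\<close>. The
    first component of \<open>V f\<close> restores precisely this loss.\<close>
  have V_iso: "dsum_ip ipk ipL (V f) (V f) = ipT f f" if f: "f \<in> T" for f
  proof -
    have D: "\<Delta> f \<in> T" using Delta f by (auto simp: is_pos_sqrt_def)
    have "ip_norm ipL (\<iota> f) = ip_norm ipT (\<Delta> f)"
      using L_Delta f by (simp add: is_hilbert_completion_def)
    then have "ipL (\<iota> f) (\<iota> f) = ipT (\<Delta> f) (\<Delta> f)"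
      by (simp add: L.ip_self \<iota>_mem f T.ip_self D)
    also have "\<dots> = ipT f (\<Delta> (\<Delta> f))"
      by (rule T.positive_imp_symmetric) (use Delta f D in \<open>auto simp: is_pos_sqrt_def\<close>)
    also have "\<Delta> (\<Delta> f) = f - Mb_adj (mult_op b f)" using Delta f by (simp add: is_pos_sqrt_def)
    also have "ipT f \<dots> = ipT f f - ipk (mult_op b f) (mult_op b f)"
      by (simp add: T.ip_diff_right f adj_mem M_mem adj_eq)
    finally show ?thesis by (simp add: dsum_ip_def V_def)
  qed
  have V_ip: "dsum_ip ipk ipL (V f) (V g) = ipT f g" if "f \<in> T" "g \<in> T" for f g
    by (rule isometry_preserves_ip[OF T.cinner_space_axioms P.cinner_space_axioms V_lin])
      (use V_mem V_iso that in auto)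
  have graph: "graph_space b T \<iota> = V ` T" by (simp add: graph_space_def V_def)
  interpret W: chilbert_space "dsum_scale fun_scale scaleL" Mperp "dsum_ip ipk ipL"
    unfolding Mperp_def graph by (rule P.chilbert_space_ortho_compl) (use V_mem in blast)
  have Mperp_mem: "w \<in> Mperp \<longleftrightarrow> w \<in> Hk \<times> L \<and> (\<forall>f\<in>T. dsum_ip ipk ipL w (V f) = 0)" for w
    by (auto simp: Mperp_def graph ortho_compl_def)

  \<comment> \<open>The projection of \<open>(k\<^sub>y, 0)\<close> onto \<open>Mperp\<close>: the graph map \<open>V\<close> is isometric, and its adjoint
    sends \<open>(k\<^sub>y, 0)\<close> to \<open>M\<^sub>b\<^sup>* k\<^sub>y\<close>.\<close>
  define p where "p y = ((\<lambda>x. k x y), 0) - V (Mb_adj (\<lambda>x. k x y))" for y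
  have k0: "((\<lambda>x. k x y), 0) \<in> Hk \<times> L" for y by (simp add: kH L.zero_mem)
  have V_adj: "V (Mb_adj (\<lambda>x. k x y)) \<in> Hk \<times> L" for y by (rule V_mem[OF adj_mem[OF kH]])
  have p_mem: "p y \<in> Mperp" for y
    unfolding Mperp_mem
  proof (intro conjI ballI)
    show "p y \<in> Hk \<times> L" unfolding p_def by (rule P.diff_mem[OF k0 V_adj])
    fix f assume f: "f \<in> T"
    have "dsum_ip ipk ipL ((\<lambda>x. k x y), 0) (V f) = ipk (\<lambda>x. k x y) (mult_op b f)"
      by (simp add: dsum_ip_def V_def L.ip_zero_left \<iota>_mem f)
    also have "\<dots> = ipT (Mb_adj (\<lambda>x. k x y)) f"
      using adj_eq[OF f kH[of y]] H.ip_commute[OF M_mem[OF f] kH[of y]]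
        T.ip_commute[OF f adj_mem[OF kH[of y]]] by simp
    finally show "dsum_ip ipk ipL (p y) (V f) = 0"
      unfolding p_def by (simp only: P.ip_diff_left[OF k0 V_adj V_mem[OF f]] V_ip[OF adj_mem[OF kH] f]) simp
  qed
  \<comment> \<open>The correction term in \<open>p y\<close> lies in the graph and is orthogonal to
    \<open>w\<close>, so only the pairing with the kernel function remains, and the reproducing
    property evaluates it.\<close>
  have p_eval: "fst w y = dsum_ip ipk ipL w (p y)" if w: "w \<in> Mperp" for w y
  proof -
    have wP: "w \<in> Hk \<times> L" and 0: "dsum_ip ipk ipL w (V (Mb_adj (\<lambda>x. k x y))) = 0"
      using w adj_mem[OF kH[of y]] unfolding Mperp_mem by blast+
    have "dsum_ip ipk ipL w ((\<lambda>x. k x y), 0) = fst w y"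
      using wP eval[of "fst w" y] by (auto simp: dsum_ip_def L.ip_zero_right)
    then show ?thesis unfolding p_def by (simp only: P.ip_diff_right[OF k0 V_adj wP] 0) simp
  qed
  have p_fst: "fst (p y) x = mult_kernel k b x y" for x y
  proof -
    let ?a = "Mb_adj (\<lambda>x. k x y)"
    have a: "?a x j = cnj (b y j) * k x y" for j
      using adjoint_kernel_component[OF Hk multiplier] adjoint unfolding T_def ipT_def by blast
    have summable: "summable (\<lambda>j. k x y * (b x j * cnj (b y j)))"
    proof -
      have "summable (\<lambda>j. b x j * ?a x j)"
        using multiplier adj_mem[OF kH[of y]] unfolding row_multiplier_def T_def by blast
      then show ?thesis by (simp add: a mult_ac)
    qed
    have "mult_op b ?a x = (\<Sum>j. k x y * (b x j * cnj (b y j)))"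
      by (simp add: mult_op_def a mult_ac)
    \<comment> \<open>Only the series with the factor \<open>k x y\<close> is known to converge. If
      the factor is nonzero it can be divided out; if it is zero, both sides vanish whatever default
      value \<open>suminf\<close> takes.\<close>
    also have "\<dots> = k x y * (\<Sum>j. b x j * cnj (b y j))"
      using summable by (cases "k x y = 0") (simp_all add: suminf_mult)
    finally show ?thesis by (simp add: p_def V_def mult_kernel_def algebra_simps)
  qed
  have inj: "inj_on fst Mperp"
  proof (rule inj_onI)
    fix w w' assume w: "w \<in> Mperp" and w': "w' \<in> Mperp" and eq: "fst w = fst w'"
    define v where "v = snd (w - w')"
    have d: "w - w' \<in> Mperp" by (rule W.diff_mem[OF w w'])
    then have v: "v \<in> L" unfolding Mperp_mem v_def by (simp add: mem_Times_iff)
    \<comment> \<open>The difference of the two elements is \<open>(0, v)\<close>, so orthogonality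
      to the graph reduces to orthogonality of \<open>v\<close> to the dense range of
      \<open>\<iota>\<close>.\<close>
    have orth: "ipL v (\<iota> f) = 0" if f: "f \<in> T" for f
    proof -
      have "dsum_ip ipk ipL (w - w') (V f) = 0" using d f by (simp add: Mperp_mem)
      then show ?thesis by (simp add: dsum_ip_def V_def v_def eq H.ip_zero_left M_mem f)
    qed
    have "(ip_norm ipL v)\<^sup>2 < e\<^sup>2" if "e > 0" for e
    proof -
      obtain f where f: "f \<in> T" "ip_norm ipL (v - \<iota> f) < e"
        using L_Delta v \<open>e > 0\<close> unfolding is_hilbert_completion_def by blast
      have "(ip_norm ipL v)\<^sup>2 \<le> (ip_norm ipL (v - \<iota> f))\<^sup>2"
        using L.ip_norm_diff_sq[OF v \<iota>_mem[OF f(1)]] orth[OF f(1)] by simp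
      also have "\<dots> < e\<^sup>2"
        using f v by (intro power_strict_mono) (auto simp: L.ip_norm_nonneg L.mem \<iota>_mem)
      finally show ?thesis .
    qed
    \<comment> \<open>A positive norm could be inserted for \<open>e\<close> and would give a number
      strictly below itself.\<close>
    from this[of "ip_norm ipL v"] have "ip_norm ipL v = 0"
      using L.ip_norm_nonneg[OF v] by force
    then have "v = 0" using L.ip_norm_eq_0[OF v] by simp
    then show "w = w'" using eq by (simp add: v_def prod_eq_iff)
  qed
  have lin: "clinear_on (dsum_scale fun_scale scaleL) fun_scale Mperp fst"
    by (simp add: clinear_on_def dsum_scale_def)
  have U: "unitary_between (dsum_scale fun_scale scaleL) Mperp (dsum_ip ipk ipL) fun_scale Hb ipb fst"
    by (rule unitary_onto_hilbert_function_space[OF W.chilbert_space_axioms Hb lin inj p_mem p_eval p_fst])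

  \<comment> \<open>Unique second components and the norm identity\<close>
  have L_mem: "f \<in> Hk \<and> g \<in> L" if "(f, g) \<in> Mperp" for f g using that by (simp add: Mperp_mem)
  have "\<exists>!g. g \<in> L \<and> (f, g) \<in> Mperp" if f: "f \<in> Hb" for f
  proof -
    have "f \<in> fst ` Mperp" using U f by (simp add: unitary_between_def bij_betw_def)
    then obtain g where g: "(f, g) \<in> Mperp" by auto
    show ?thesis
    proof (rule ex1I[of _ g])
      show "g \<in> L \<and> (f, g) \<in> Mperp" using g L_mem by blast
      show "h = g" if "h \<in> L \<and> (f, h) \<in> Mperp" for h
        using inj_onD[OF inj, of "(f, h)" "(f, g)"] g that by simp
    qed
  qed
  moreover have "(ip_norm ipb f)\<^sup>2 = (ip_norm ipk f)\<^sup>2 + (ip_norm ipL g)\<^sup>2" if fg: "(f, g) \<in> Mperp" for f g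
  proof -
    have "ipb f f = dsum_ip ipk ipL (f, g) (f, g)"
      using U fg unfolding unitary_between_def by (metis fst_conv)
    then have "ipb f f = of_real ((ip_norm ipk f)\<^sup>2 + (ip_norm ipL g)\<^sup>2)"
      using L_mem[OF fg] by (simp add: dsum_ip_def H.ip_self L.ip_self)
    then show ?thesis by (simp add: ip_norm_def[of ipb])
  qed
  ultimately show ?thesis using U by blast
qed

end
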